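(* Let $\mathcal{R}=\{1,\dots,n\}$ be a route set with durations $l_i\in\mathbb{R}$ and let $T>0$. Let $x$ be an optimal solution of $$\min\ \frac1T\sum_{i\in\mathcal{R}}\left(\frac12x_i^2+l_ix_i\right)\quad\text{s.t.}\quad\sum_{i\in\mathcal{R}}x_i=T,\quad x_i\ge0\ \ \forall i\in\mathcal{R}.$$ Define the timetable $\boldsymbol{\theta}$ by $\theta_1=0$ and $\theta_i=\theta_{i-1}+x_i$ for $i=2,\dots,n$ (departure times read modulo $T$). Then $\boldsymbol{\theta}$ is an optimal timetable for shortest path routing, i.e. it minimizes $\mathcal{M}^{TT}_{sp}(\mathcal{R},T,\cdot)$ over all timetables in $[0,T)^n$, and $\mathcal{M}^{TT}_{sp}(\mathcal{R},T,\boldsymbol{\theta})$ equals the optimal objective value $$\min\left\{\frac1T\sum_{i\in\mathcal{R}}\left(\frac12u_i^2+l_iu_i\right)\ :\ \sum_{i\in\mathcal{R}}u_i=T,\ u_i\ge0\ \ \forall i\in\mathcal{R}\right\}.$$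
   Context: A timetable assigns to each route $i$ a departure time $\theta_i\in[0,T)$; route $i$ departs at times $\theta_i+zT$, $z\in\mathbb{Z}$. For $x\in\mathbb{R}$, $[x]_T$ denotes the element of $[0,T)$ differing from $x$ by an integer multiple of $T$. The timetable measure for shortest path routing (under uniform demand) is $$\mathcal{M}^{TT}_{sp}(\mathcal{R},T,\boldsymbol{\theta})=\mathbb{E}_t\left(\min_{i\in\mathcal{R}}\{l_i+[\theta_i-t]_T\}\right),$$ with $t$ uniformly distributed on $[0,T)$. *)

theory Defs
  imports "HOL-Probability.Probability" "HOL-Library.Real_Mod"
begin

text \<open>
  Durations, timetables and allocations on a route set \<open>R\<close> are total functions on the index type;
  only their values on \<open>R\<close> matter.
  For \<open>T > 0\<close>, \<open>x rmod T\<close> is the representative of \<open>x\<close> modulo \<open>T\<close> in \<open>[0, T)\<close>.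
\<close>

definition timetables :: "'a set \<Rightarrow> real \<Rightarrow> ('a \<Rightarrow> real) set" where
  "timetables R T = {\<theta>. \<forall>i\<in>R. \<theta> i \<in> {0..<T}}"

definition sp_measure :: "'a set \<Rightarrow> ('a \<Rightarrow> real) \<Rightarrow> real \<Rightarrow> ('a \<Rightarrow> real) \<Rightarrow> real" where
  "sp_measure R l T \<theta> =
     prob_space.expectation (uniform_measure lborel {0..<T})
       (\<lambda>t. MIN i\<in>R. l i + (\<theta> i - t) rmod T)"

definition feasible :: "'a set \<Rightarrow> real \<Rightarrow> ('a \<Rightarrow> real) set" where
  "feasible R T = {u. (\<Sum>i\<in>R. u i) = T \<and> (\<forall>i\<in>R. 0 \<le> u i)}"

definition objective :: "'a set \<Rightarrow> ('a \<Rightarrow> real) \<Rightarrow> real \<Rightarrow> ('a \<Rightarrow> real) \<Rightarrow> real" where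
  "objective R l T u = 1 / T * (\<Sum>i\<in>R. 1 / 2 * (u i)\<^sup>2 + l i * u i)"

end

theory Submission
  imports Defs
begin

text \<open>
  Write \<open>f t = (MIN i\<in>R. l i + (\<theta> i - t) rmod T)\<close> for the travel time of a passenger arriving at
  time \<open>t\<close>; the measure of a timetable is the mean of \<open>f\<close> over one period. The theorem sandwiches
  the integral of \<open>f\<close> between values of the quadratic program.

  For the lower bound, linear programming duality for a minimum of finitely many numbers gives
  \<open>(MIN i\<in>R. a i) \<ge> \<mu> - (\<Sum>i\<in>R. max 0 (\<mu> - a i))\<close> for every \<open>\<mu>\<close> (\<open>Min_ge_dual\<close>).
  Take \<open>a i = l i + (\<theta> i - t) rmod T\<close> and integrate over the period. The waiting
  time \<open>(\<theta> i - t) rmod T\<close> runs through \<open>[0, T)\<close> exactly once, whatever \<open>\<theta> i\<close> is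
  (\<open>has_integral_waiting_time\<close>), so the bound becomes \<open>\<mu> * T - (\<Sum>i\<in>R. (max 0 (\<mu> - l i))\<^sup>2 / 2)\<close>
  and does not depend on the timetable. If \<open>\<mu>\<close> is the water level at which the amounts
  \<open>u i = max 0 (\<mu> - l i)\<close> add up to \<open>T\<close>, which exists by the intermediate value theorem
  (\<open>ex_water_level\<close>), then \<open>u\<close> is feasible and the bound is \<open>T\<close> times its objective value.
  So the optimal objective value bounds the measure of every timetable from below
  (\<open>ex_allocation_below_sp_measures\<close>). Here \<open>\<mu>\<close> is the Lagrange multiplier of the
  constraint on the sum, and the comparison with \<open>x\<close> is immediate because \<open>u\<close> is feasible.

  For the upper bound, space the departures by \<open>x\<close>: the intervals of lengths \<open>x 2\<close>, ..., \<open>x n\<close>,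
  \<open>x 1\<close>, laid end to end, fill \<open>[0, T]\<close>, and each ends with a departure of its own route. A
  passenger who takes that route travels for \<open>l i\<close> plus the time to the end of the interval,
  which integrates to \<open>(x i)\<^sup>2 / 2 + l i * x i\<close>; the fastest route is at least as good
  (\<open>sp_measure_spaced_departures_le\<close>).
\<close>

section \<open>The timetable measure as an integral over one period\<close>

definition travel_time :: "'a set \<Rightarrow> ('a \<Rightarrow> real) \<Rightarrow> real \<Rightarrow> ('a \<Rightarrow> real) \<Rightarrow> real \<Rightarrow> real" where
  "travel_time R l T \<theta> t = (MIN i\<in>R. l i + (\<theta> i - t) rmod T)"

lemma borel_measurable_rmod [measurable (raw)]:
  assumes [measurable]: "f \<in> borel_measurable M"
  shows "(\<lambda>t. f t rmod T) \<in> borel_measurable M"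
  unfolding rmod_def by measurable

lemma borel_measurable_travel_time:
  assumes "finite R"
  shows "travel_time R l T \<theta> \<in> borel_measurable borel"
proof -
  have "(\<lambda>t. MIN i\<in>R. l i + (\<theta> i - t) rmod T) \<in> borel_measurable borel"
    using assms by (rule borel_measurable_Min) measurable
  then show ?thesis
    by (simp add: travel_time_def[abs_def])
qed

lemma travel_time_bounded:
  assumes "finite R" "R \<noteq> {}" "T > 0"
  shows "\<bar>travel_time R l T \<theta> t\<bar> \<le> (\<Sum>i\<in>R. \<bar>l i\<bar>) + T"
proof -
  have "travel_time R l T \<theta> t \<in> (\<lambda>i. l i + (\<theta> i - t) rmod T) ` R"
    unfolding travel_time_def using assms by (intro Min_in) auto
  then obtain i where i: "i \<in> R" "travel_time R l T \<theta> t = l i + (\<theta> i - t) rmod T"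
    by auto
  have "\<bar>l i\<bar> \<le> (\<Sum>i\<in>R. \<bar>l i\<bar>)"
    using i assms by (intro member_le_sum) auto
  moreover have "0 \<le> (\<theta> i - t) rmod T" "(\<theta> i - t) rmod T \<le> T"
    using assms by (auto intro: rmod_nonneg rmod_le)
  ultimately show ?thesis
    using i by linarith
qed

lemma set_integrable_travel_time:
  assumes "finite R" "R \<noteq> {}" "T > 0"
  shows "set_integrable lborel {0..T} (travel_time R l T \<theta>)"
  unfolding set_integrable_def
proof (rule integrableI_bounded_set_indicator[where B = "(\<Sum>i\<in>R. \<bar>l i\<bar>) + T"])
  show "AE t in lborel. t \<in> {0..T} \<longrightarrow> norm (travel_time R l T \<theta> t) \<le> (\<Sum>i\<in>R. \<bar>l i\<bar>) + T"
    using travel_time_bounded[OF assms, of l \<theta>] by simp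
qed (use borel_measurable_travel_time[OF assms(1)] in \<open>auto simp: emeasure_lborel_Icc_eq\<close>)

lemma travel_time_integrable_on:
  assumes "finite R" "R \<noteq> {}" "T > 0"
  shows "travel_time R l T \<theta> integrable_on {0..T}"
  using set_borel_integral_eq_integral(1)[OF set_integrable_travel_time[OF assms]] .

lemma sp_measure_eq_integral:
  assumes "finite R" "R \<noteq> {}" "T > 0"
  shows "sp_measure R l T \<theta> = 1 / T * integral {0..T} (travel_time R l T \<theta>)"
proof -
  let ?f = "travel_time R l T \<theta>"
  have "uniform_measure lborel {0..<T} = density lborel (\<lambda>t. ennreal (indicat_real {0..<T} t / T))"
    unfolding uniform_measure_def using assms
    by (intro density_cong) (auto simp: indicator_def divide_ennreal simp flip: ennreal_1)
  then have "sp_measure R l T \<theta> = (\<integral>t. (indicat_real {0..<T} t / T) *\<^sub>R ?f t \<partial>lborel)"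
    unfolding sp_measure_def travel_time_def[symmetric] using assms
    by (simp only:) (intro integral_density, use borel_measurable_travel_time[OF assms(1)] in auto)
  also have "\<dots> = (\<integral>t. (1 / T) * (indicat_real {0..T} t *\<^sub>R ?f t) \<partial>lborel)"
  proof (rule integral_cong_AE)
    show "AE t in lborel. (indicat_real {0..<T} t / T) *\<^sub>R ?f t
        = (1 / T) * (indicat_real {0..T} t *\<^sub>R ?f t)"
      using AE_lborel_singleton[of T] by eventually_elim (auto simp: indicator_def)
  qed (use borel_measurable_travel_time[OF assms(1), of l T \<theta>] in measurable)
  also have "\<dots> = 1 / T * (LINT t:{0..T}|lborel. ?f t)"
    unfolding set_lebesgue_integral_def by (rule integral_mult_right_zero)
  also have "(LINT t:{0..T}|lborel. ?f t) = integral {0..T} ?f"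
    using set_borel_integral_eq_integral(2)[OF set_integrable_travel_time[OF assms]] .
  finally show ?thesis .
qed

section \<open>No timetable beats the optimal allocation\<close>

text \<open>
  Over one period the waiting time is uniformly distributed: it falls from \<open>\<theta>\<close> to \<open>0\<close> before the
  departure and from \<open>T\<close> to \<open>\<theta>\<close> after it, so the two reflected halves of \<open>h\<close> reassemble to \<open>h\<close>.
\<close>

lemma has_integral_waiting_time:
  fixes h :: "real \<Rightarrow> real"
  assumes \<theta>: "\<theta> \<in> {0..<T}" and h: "(h has_integral I) {0..T}"
  shows "((\<lambda>t. h ((\<theta> - t) rmod T)) has_integral I) {0..T}"
proof -
  have "h integrable_on {0..\<theta>}" "h integrable_on {\<theta>..T}"
    using integrable_subinterval_real[of h 0 T] h \<theta> by (auto simp: has_integral_iff)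
  then obtain I1 I2 where I1: "(h has_integral I1) {0..\<theta>}" and I2: "(h has_integral I2) {\<theta>..T}"
    by (auto simp: integrable_on_def)
  have "(h has_integral I1 + I2) {0..T}"
    using \<theta> I1 I2 by (intro has_integral_combine[of 0 \<theta> T]) auto
  then have I: "I = I1 + I2"
    using h by (rule has_integral_unique[symmetric])
  \<comment> \<open>Before the departure the wait is for the service of this period,
    afterwards for that of the next one.\<close>
  have "((\<lambda>t. h (- t + \<theta>)) has_integral I1) {0..\<theta>}"
    using has_integral_affinity[of h I1 0 \<theta> "-1" \<theta>] I1 \<theta> by (simp)
  then have 1: "((\<lambda>t. h ((\<theta> - t) rmod T)) has_integral I1) {0..\<theta>}"
    by (rule has_integral_eq[rotated]) (use \<theta> in \<open>auto simp: algebra_simps\<close>)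
  have "((\<lambda>t. h (- t + (\<theta> + T))) has_integral I2) {\<theta>..T}"
    using has_integral_affinity[of h I2 \<theta> T "-1" "\<theta> + T"] I2 \<theta> by (simp)
  \<comment> \<open>At the departure itself the waiting time is \<open>0\<close> and not \<open>T\<close>, so one point is left out.\<close>
  then have 2: "((\<lambda>t. h ((\<theta> - t) rmod T)) has_integral I2) {\<theta>..T}"
  proof (rule has_integral_spike_finite[of "{\<theta>}", rotated 2])
    fix t assume t: "t \<in> {\<theta>..T} - {\<theta>}"
    have "(\<theta> - t) rmod T = \<theta> - t + T"
      by (rule rmod_unique[of _ _ _ "-1"]) (use t \<theta> in auto)
    then show "h ((\<theta> - t) rmod T) = h (- t + (\<theta> + T))"
      by (simp only: minus_add_cancel add_ac diff_conv_add_uminus)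
  qed auto
  show ?thesis
    unfolding I using \<theta> 1 2 by (intro has_integral_combine[of 0 \<theta> T]) auto
qed

text \<open>
  The region under the graph is a right triangle with legs of length \<open>max 0 c\<close>; \<open>c \<le> T\<close> keeps it
  inside the period.
\<close>

lemma has_integral_positive_part:
  fixes c T :: real
  assumes "0 \<le> T" "c \<le> T"
  shows "((\<lambda>s. max 0 (c - s)) has_integral (max 0 c)\<^sup>2 / 2) {0..T}"
proof (cases "c \<le> 0")
  case True
  have "((\<lambda>s. max 0 (c - s)) has_integral 0) {0..T}"
    using True by (intro has_integral_is_0) auto
  then show ?thesis
    using True by simp
next
  case False
  have "((\<lambda>s. c - s) has_integral (- (c - c)\<^sup>2 / 2) - (- (c - 0)\<^sup>2 / 2)) {0..c}"
    using False
    by (intro fundamental_theorem_of_calculus)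
       (auto intro!: derivative_eq_intros simp: field_simps
             simp flip: has_real_derivative_iff_has_vector_derivative)
  then have 1: "((\<lambda>s. max 0 (c - s)) has_integral c\<^sup>2 / 2) {0..c}"
    by (rule has_integral_eq[rotated, where f = "\<lambda>s. c - s", THEN has_integral_eq_rhs]) auto
  have 2: "((\<lambda>s. max 0 (c - s)) has_integral 0) {c..T}"
    by (intro has_integral_is_0) auto
  show ?thesis
    using has_integral_combine[OF _ _ 1 2] False assms by auto
qed

text \<open>
  Water filling: as the level \<open>\<mu>\<close> rises from the lowest duration, the total amount grows
  continuously from \<open>0\<close>, and it is at least \<open>T\<close> at height \<open>T\<close> above the highest one.
\<close>

lemma ex_water_level:
  fixes l :: "'a \<Rightarrow> real"
  assumes "finite R" "R \<noteq> {}" "T > 0"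
  shows "\<exists>\<mu>. (\<Sum>i\<in>R. max 0 (\<mu> - l i)) = T"
proof -
  obtain j where j: "j \<in> R"
    using assms by auto
  let ?a = "Min (l ` R)" and ?b = "Max (l ` R) + T"
  have *: "?a \<le> l i" "l i \<le> Max (l ` R)" if "i \<in> R" for i
    using assms that by auto
  have "(\<Sum>i\<in>R. max 0 (?a - l i)) = 0"
    using * by (intro sum.neutral) auto
  moreover have "T \<le> (\<Sum>i\<in>R. max 0 (?b - l i))"
  proof -
    have "T \<le> max 0 (?b - l j)"
      using *[OF j] by auto
    also have "\<dots> \<le> (\<Sum>i\<in>R. max 0 (?b - l i))"
      using assms j by (intro member_le_sum) auto
    finally show ?thesis .
  qed
  moreover have "?a \<le> ?b"
    using *[OF j] assms by linarith
  ultimately show ?thesis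
    using IVT'[of "\<lambda>\<mu>. \<Sum>i\<in>R. max 0 (\<mu> - l i)" ?a T ?b] assms
    by (fastforce intro!: continuous_intros)
qed

text \<open>
  Each entry satisfies \<open>a j \<ge> \<mu> - max 0 (\<mu> - a j)\<close>, and the other terms only lower the bound. Unlike the minimum, the bound is a sum of functions of one
  entry each, so it can be integrated route by route.
\<close>

lemma Min_ge_dual:
  fixes a :: "'a \<Rightarrow> real"
  assumes "finite R" "R \<noteq> {}"
  shows "\<mu> - (\<Sum>i\<in>R. max 0 (\<mu> - a i)) \<le> (MIN i\<in>R. a i)"
proof -
  have "\<mu> - (\<Sum>i\<in>R. max 0 (\<mu> - a i)) \<le> a j" if "j \<in> R" for j
  proof -
    have "\<mu> - a j \<le> max 0 (\<mu> - a j)"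
      by simp
    also have "\<dots> \<le> (\<Sum>i\<in>R. max 0 (\<mu> - a i))"
      using assms that by (intro member_le_sum) auto
    finally show ?thesis by simp
  qed
  then show ?thesis
    using assms by auto
qed

text \<open>
  The allocation is the water filling \<open>u i = max 0 (\<mu> - l i)\<close>. The integrated dual bound is
  \<open>\<mu> * T - (\<Sum>i\<in>R. (u i)\<^sup>2 / 2)\<close>, and it equals the unnormalised objective of \<open>u\<close> since
  \<open>\<mu> * u i = (u i)\<^sup>2 + l i * u i\<close> for every route: either \<open>u i = 0\<close> or \<open>\<mu> = u i + l i\<close>.
\<close>

lemma ex_allocation_below_sp_measures:
  assumes "finite R" "R \<noteq> {}" "T > 0"
  shows "\<exists>u\<in>feasible R T. \<forall>\<theta>\<in>timetables R T. objective R l T u \<le> sp_measure R l T \<theta>"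
proof -
  obtain \<mu> where \<mu>: "(\<Sum>i\<in>R. max 0 (\<mu> - l i)) = T"
    using ex_water_level[OF assms] by blast
  define u where "u i = max 0 (\<mu> - l i)" for i
  have sum_u: "sum u R = T"
    using \<mu> by (simp add: u_def)
  have "u \<in> feasible R T"
    using sum_u by (simp add: feasible_def u_def)
  moreover have "objective R l T u \<le> sp_measure R l T \<theta>" if \<theta>: "\<theta> \<in> timetables R T" for \<theta>
  proof -
    have dual: "((\<lambda>t. \<mu> - (\<Sum>i\<in>R. max 0 ((\<mu> - l i) - (\<theta> i - t) rmod T)))
        has_integral \<mu> * T - (\<Sum>i\<in>R. (u i)\<^sup>2 / 2)) {0..T}"
    proof (intro has_integral_diff has_integral_sum)
      show "((\<lambda>t. \<mu>) has_integral \<mu> * T) {0..T}"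
        using has_integral_const_real[of \<mu> 0 T] assms by (simp add: mult.commute)
      fix i assume i: "i \<in> R"
      have "\<mu> - l i \<le> u i"
        by (simp add: u_def)
      also have "u i \<le> sum u R"
        using assms i by (intro member_le_sum) (auto simp: u_def)
      finally have "\<mu> - l i \<le> T"
        by (simp add: sum_u)
      then show "((\<lambda>t. max 0 ((\<mu> - l i) - (\<theta> i - t) rmod T)) has_integral (u i)\<^sup>2 / 2) {0..T}"
        unfolding u_def using \<theta> i assms
        by (intro has_integral_waiting_time[where h = "\<lambda>s. max 0 (\<mu> - l i - s)"]
                  has_integral_positive_part)
           (auto simp: timetables_def)
    qed (use assms in auto)
    have "\<mu> * T = (\<Sum>i\<in>R. \<mu> * u i)"
      by (simp add: sum_distrib_left flip: sum_u)
    also have "\<dots> = (\<Sum>i\<in>R. (u i)\<^sup>2 + l i * u i)"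
      by (intro sum.cong) (auto simp: u_def max_def power2_eq_square algebra_simps)
    finally have "(\<Sum>i\<in>R. 1 / 2 * (u i)\<^sup>2 + l i * u i) = \<mu> * T - (\<Sum>i\<in>R. (u i)\<^sup>2 / 2)"
      by (simp add: sum_subtractf[symmetric] field_simps)
    also have "\<dots> \<le> integral {0..T} (travel_time R l T \<theta>)"
    proof (rule has_integral_le[OF dual integrable_integral[OF travel_time_integrable_on[OF assms]]])
      fix t
      show "\<mu> - (\<Sum>i\<in>R. max 0 ((\<mu> - l i) - (\<theta> i - t) rmod T)) \<le> travel_time R l T \<theta> t"
        unfolding travel_time_def
        using Min_ge_dual[of R \<mu> "\<lambda>i. l i + (\<theta> i - t) rmod T"] assms
        by (simp add: algebra_simps)
    qed
    finally show ?thesis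
      using assms by (simp add: objective_def sp_measure_eq_integral divide_right_mono)
  qed
  ultimately show ?thesis
    by blast
qed

section \<open>Spacing the departures by an allocation\<close>

lemma rmod_le_self:
  assumes "0 \<le> y" "0 < T"
  shows "y rmod T \<le> y"
  using assms by (simp add: rmod_def)

text \<open>
  Passengers arriving during an interval that ends with a departure of route \<open>i\<close> can all wait for
  that departure. At \<open>t = b - T\<close> the residue \<open>(b - t) rmod T\<close> is \<open>0\<close> and not \<open>b - t\<close>, which
  only helps; hence an interval that fills the whole period needs no separate treatment.
\<close>

lemma integral_travel_time_le:
  assumes R: "finite R" "i \<in> R" and T: "T > 0"
    and ab: "0 \<le> a" "a \<le> b" "b \<le> T" and \<theta>: "[\<theta> i = b] (rmod T)"
  shows "integral {a..b} (travel_time R l T \<theta>) \<le> 1 / 2 * (b - a)\<^sup>2 + l i * (b - a)"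
proof -
  have "travel_time R l T \<theta> integrable_on {a..b}"
    by (rule integrable_subinterval_real[OF travel_time_integrable_on]) (use R T ab in auto)
  moreover have "((\<lambda>t. l i + (b - t)) has_integral
      (- (b - b)\<^sup>2 / 2 + l i * b) - (- (b - a)\<^sup>2 / 2 + l i * a)) {a..b}"
    using ab
    by (intro fundamental_theorem_of_calculus)
       (auto intro!: derivative_eq_intros simp: field_simps
             simp flip: has_real_derivative_iff_has_vector_derivative)
  moreover have "travel_time R l T \<theta> t \<le> l i + (b - t)" if t: "t \<in> {a..b}" for t
  proof -
    have "travel_time R l T \<theta> t \<le> l i + (\<theta> i - t) rmod T"
      unfolding travel_time_def using R by (intro Min_le) auto
    also have "(\<theta> i - t) rmod T = (b - t) rmod T"
      using rcong_diff[OF \<theta> rcong_refl[of t T]] by (simp add: rcong_def)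
    also have "\<dots> \<le> b - t"
      using t T by (intro rmod_le_self) auto
    finally show ?thesis by simp
  qed
  ultimately have "integral {a..b} (travel_time R l T \<theta>)
      \<le> (- (b - b)\<^sup>2 / 2 + l i * b) - (- (b - a)\<^sup>2 / 2 + l i * a)"
    by (intro has_integral_le[OF integrable_integral])
  then show ?thesis
    by (simp add: algebra_simps)
qed

text \<open>
  The interval of route \<open>k \<ge> 2\<close> ends at \<open>x 2 + \<dots> + x k\<close>, which is \<open>\<theta> k\<close> modulo \<open>T\<close>. Route \<open>1\<close>
  departs at \<open>0\<close>, that is at \<open>T\<close>, and so it takes the last interval of the period; the
  total length \<open>T\<close> makes this interval exactly \<open>x 1\<close> long.
\<close>

lemma sp_measure_spaced_departures_le:
  fixes x \<theta> :: "nat \<Rightarrow> real"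
  assumes T: "T > 0" and n: "1 \<le> n" and x: "x \<in> feasible {1..n} T"
    and \<theta>1: "\<theta> 1 = 0"
    and \<theta>: "\<And>i. i \<in> {2..n} \<Longrightarrow> \<theta> i = (\<theta> (i - 1) + x i) rmod T"
  shows "sp_measure {1..n} l T \<theta> \<le> objective {1..n} l T x"
proof -
  let ?f = "travel_time {1..n} l T \<theta>"
  define c where "c k = (\<Sum>i\<in>{2..k}. x i)" for k
  have x_nonneg: "x i \<ge> 0" if "i \<in> {1..n}" for i
    using x that by (simp add: feasible_def)
  have split: "sum g {1..n} = g 1 + sum g {2..n}" for g :: "nat \<Rightarrow> real"
    using sum.atLeast_Suc_atMost[OF n, of g] by (simp add: numeral_2_eq_2)
  have total: "x 1 + c n = T"
    using x split[of x] by (simp add: feasible_def c_def)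
  have c_Suc: "c (Suc k) = c k + x (Suc k)" if "1 \<le> k" for k
    using that by (simp add: c_def)
  have c_bounds: "0 \<le> c k" "c k \<le> T" if "k \<le> n" for k
  proof -
    show "0 \<le> c k"
      unfolding c_def using that x_nonneg by (intro sum_nonneg) auto
    have "c k \<le> c n"
      unfolding c_def using that x_nonneg by (intro sum_mono2) auto
    also have "\<dots> \<le> T"
      using total x_nonneg[of 1] n by simp
    finally show "c k \<le> T" .
  qed
  have integrable: "?f integrable_on {0..c}" if "c \<le> T" for c
    by (rule integrable_subinterval_real[OF travel_time_integrable_on]) (use n T that in auto)
  have main: "[\<theta> k = c k] (rmod T) \<and>
      integral {0..c k} ?f \<le> (\<Sum>i\<in>{2..k}. 1 / 2 * (x i)\<^sup>2 + l i * x i)" if "1 \<le> k" "k \<le> n" for k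
    using that
  proof (induction k rule: dec_induct)
    case base
    then show ?case
      using \<theta>1 by (simp add: c_def)
  next
    case (step k)
    have IH: "[\<theta> k = c k] (rmod T)"
        "integral {0..c k} ?f \<le> (\<Sum>i\<in>{2..k}. 1 / 2 * (x i)\<^sup>2 + l i * x i)"
      using step by auto
    have cong: "[\<theta> (Suc k) = c (Suc k)] (rmod T)"
      using \<theta>[of "Suc k"] step IH(1) by (simp add: c_Suc)
    have "integral {0..c (Suc k)} ?f = integral {0..c k} ?f + integral {c k..c (Suc k)} ?f"
      using step c_bounds[of k] c_bounds[of "Suc k"] x_nonneg[of "Suc k"]
      by (intro Henstock_Kurzweil_Integration.integral_combine[symmetric] integrable)
         (auto simp: c_Suc)
    also have "integral {c k..c (Suc k)} ?f \<le> 1 / 2 * (x (Suc k))\<^sup>2 + l (Suc k) * x (Suc k)"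
      using integral_travel_time_le[of "{1..n}" "Suc k" T "c k" "c (Suc k)" \<theta> l]
        cong step T c_bounds[of k] c_bounds[of "Suc k"] x_nonneg[of "Suc k"]
      by (simp add: c_Suc)
    finally show ?case
      using IH(2) cong step by simp
  qed
  have "[\<theta> 1 = T] (rmod T)"
    using \<theta>1 by (simp add: rcong_def)
  then have last: "integral {c n..T} ?f \<le> 1 / 2 * (x 1)\<^sup>2 + l 1 * x 1"
    using integral_travel_time_le[of "{1..n}" 1 T "c n" T \<theta> l] n T c_bounds[of n]
    by (simp flip: total)
  have "integral {0..T} ?f = integral {0..c n} ?f + integral {c n..T} ?f"
    using c_bounds[of n]
    by (intro Henstock_Kurzweil_Integration.integral_combine[symmetric] integrable) auto
  also have "\<dots> \<le> (\<Sum>i\<in>{1..n}. 1 / 2 * (x i)\<^sup>2 + l i * x i)"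
    unfolding split using main[OF n order_refl] last by linarith
  finally show ?thesis
    using T n by (simp add: objective_def sp_measure_eq_integral divide_right_mono)
qed

theorem proposition14:
  fixes n :: nat and l x \<theta> :: "nat \<Rightarrow> real" and T :: real
  assumes "T > 0"
    and "is_arg_min (objective {1..n} l T) (\<lambda>u. u \<in> feasible {1..n} T) x"
    and "\<theta> 1 = 0"
    and "\<And>i. i \<in> {2..n} \<Longrightarrow> \<theta> i = (\<theta> (i - 1) + x i) rmod T"
  shows "is_arg_min (sp_measure {1..n} l T) (\<lambda>\<theta>'. \<theta>' \<in> timetables {1..n} T) \<theta>
    \<and> sp_measure {1..n} l T \<theta> = (LEAST v. v \<in> objective {1..n} l T ` feasible {1..n} T)"
proof -
  have x: "x \<in> feasible {1..n} T"
    and x_opt: "\<And>u. u \<in> feasible {1..n} T \<Longrightarrow> objective {1..n} l T x \<le> objective {1..n} l T u"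
    using assms(2) by (auto simp: is_arg_min_linorder)
  have n: "1 \<le> n"
    using x assms(1) by (cases n) (auto simp: feasible_def)
  have lower: "objective {1..n} l T x \<le> sp_measure {1..n} l T \<theta>'"
    if "\<theta>' \<in> timetables {1..n} T" for \<theta>'
    using ex_allocation_below_sp_measures[of "{1..n}" T l] x_opt that n assms(1)
    by (force intro: order_trans)
  have upper: "sp_measure {1..n} l T \<theta> \<le> objective {1..n} l T x"
    using assms x n by (intro sp_measure_spaced_departures_le) auto
  have \<theta>: "\<theta> \<in> timetables {1..n} T"
    unfolding timetables_def
  proof safe
    fix i assume "i \<in> {1..n}"
    then show "\<theta> i \<in> {0..<T}"
      using assms by (cases "i = 1") (auto simp: rmod_nonneg rmod_less)
  qed
  have "sp_measure {1..n} l T \<theta> = objective {1..n} l T x"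
    using lower[OF \<theta>] upper by simp
  moreover have "(LEAST v. v \<in> objective {1..n} l T ` feasible {1..n} T) = objective {1..n} l T x"
    using x x_opt by (intro Least_equality) auto
  ultimately show ?thesis
    using \<theta> lower by (simp add: is_arg_min_linorder)
qed

end
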